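(* Let $n \geq 2$. The maximum modulus among all Wiener roots of connected graphs of order $n$ is $\binom{n}{2}-1$; that is, every root $z$ of $W(G;x)$ for a connected graph $G$ of order $n$ satisfies $|z|\le \binom{n}{2}-1$, and this value is attained. Moreover, for $n \geq 3$, $K_n-e$ (the complete graph on $n$ vertices with one edge removed) is the unique connected graph of order $n$ having a Wiener root of modulus $\binom{n}{2}-1$.
   Context: For a connected graph $G$ of order at least $2$, the Wiener polynomial is $W(G;x)=\sum x^{d(u,v)}$, where $d(u,v)$ is the distance between $u$ and $v$ and the sum ranges over all unordered pairs of distinct vertices. A Wiener root of $G$ is a (complex) root of $W(G;x)$. Graphs are simple. *)

theory Defs
  imports
    Complex_Main
    "HOL-Computational_Algebra.Polynomial"
    "Graph_Theory.Graph_Theory"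
begin

text \<open>
  A simple graph is a \<^locale>\<open>pair_graph\<close>: a finite, loop-free, symmetric relation on
  a vertex set, an undirected edge between u and v being the two arcs (u,v) and (v,u).
  \<^const>\<open>Digraph_Component.connected\<close> is written with its qualifier because
  topological connectedness has the same base name.
\<close>

definition connected_graph_of_order :: "nat \<Rightarrow> 'a pair_pre_digraph \<Rightarrow> bool" where
  "connected_graph_of_order n G \<longleftrightarrow>
     pair_graph G \<and> Digraph_Component.connected (with_proj G) \<and> card (pverts G) = n"

definition graph_dist :: "'a pair_pre_digraph \<Rightarrow> 'a \<Rightarrow> 'a \<Rightarrow> nat" where
  "graph_dist G u v = (LEAST k. \<exists>p. pre_digraph.apath (with_proj G) u p v \<and> length p = k)"

text \<open>
  Distance as a function of an unordered pair; it is well defined because distance is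
  symmetric, see \<open>pair_dist_doubleton\<close> below.
\<close>

definition pair_dist :: "'a pair_pre_digraph \<Rightarrow> 'a set \<Rightarrow> nat" where
  "pair_dist G e = (THE d. \<exists>u v. e = {u, v} \<and> d = graph_dist G u v)"

definition wiener_poly :: "'a pair_pre_digraph \<Rightarrow> complex poly" where
  "wiener_poly G = (\<Sum>e\<in>{e. e \<subseteq> pverts G \<and> card e = 2}. monom 1 (pair_dist G e))"

definition wiener_roots :: "'a pair_pre_digraph \<Rightarrow> complex set" where
  "wiener_roots G = {z. poly (wiener_poly G) z = 0}"

definition complete_graph :: "nat \<Rightarrow> nat pair_pre_digraph" where
  "complete_graph n = \<lparr> pverts = {..<n}, parcs = {(u, v). u < n \<and> v < n \<and> u \<noteq> v} \<rparr>"

definition del_edge :: "'a pair_pre_digraph \<Rightarrow> 'a \<Rightarrow> 'a \<Rightarrow> 'a pair_pre_digraph" where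
  "del_edge G u v = G\<lparr> parcs := parcs G - {(u, v), (v, u)} \<rparr>"

text \<open>
  Up to isomorphism the result does not depend on which edge of the complete graph is
  removed; for n at least 2 the edge between 0 and 1 is present.
\<close>

definition complete_graph_minus_edge :: "nat \<Rightarrow> nat pair_pre_digraph" where
  "complete_graph_minus_edge n = del_edge (complete_graph n) 0 1"

lemma complete_digraph_complete_graph: "complete_digraph n (with_proj (complete_graph n))"
  unfolding complete_digraph_pair_def by (auto simp: complete_graph_def)

lemma graph_dist_commute:
  assumes "pair_graph G"
  shows "graph_dist G u v = graph_dist G v u"
proof -
  interpret pair_graph G by fact
  have *: "\<exists>q. apath v q u \<and> length q = length p" if "apath u p v" for u v p
  proof (intro exI conjI)
    show "apath v (rev_path p) u" using that by simp
    show "length (rev_path p) = length p" by (induct p) auto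
  qed
  have "(\<exists>p. apath u p v \<and> length p = k) \<longleftrightarrow> (\<exists>p. apath v p u \<and> length p = k)" for k
    using * by metis
  then show ?thesis by (simp add: graph_dist_def)
qed

lemma pair_dist_doubleton:
  assumes "pair_graph G"
  shows "pair_dist G {u, v} = graph_dist G u v"
  unfolding pair_dist_def
  by (rule the_equality) (auto simp: doubleton_eq_iff graph_dist_commute[OF assms])

end

theory Submission
  imports Defs
begin

text \<open>
  Write the Wiener polynomial as the sum of \<open>c\<^sub>k x\<^sup>k\<close>, where \<open>c\<^sub>k\<close> counts the pairs at distance k,
  and let N = n choose 2 be the sum of all \<open>c\<^sub>k\<close>. On a shortest path all smaller distances occur, so
  the \<open>c\<^sub>k\<close> are positive from 1 up to the degree, and by the Enestroem-Kakeya theorem every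
  root has modulus at most any R with \<open>c\<^sub>k \<le> R c\<^sub>k\<^sub>+\<^sub>1\<close> for all such consecutive indices. As \<open>c\<^sub>k + c\<^sub>k\<^sub>+\<^sub>1 \<le> N\<close>,
  R = N - 1 always works. Even R = N - 2 works unless some \<open>c\<^sub>k\<^sub>+\<^sub>1 = 1\<close> and \<open>c\<^sub>k = N - 1\<close>; then no
  other distance occurs, which forces k = 1, so exactly one pair of vertices is not adjacent.
\<close>

section \<open>The Enestroem-Kakeya bound\<close>

text \<open>Multiplying by \<open>z - R\<close> combines neighbouring coefficients; a ratio bound
  makes all subtracted coefficients nonnegative. The ring is arbitrary because the identity is
  needed both at a complex root and at its real modulus.\<close>

lemma enestroem_kakeya_identity:
  fixes a :: "nat \<Rightarrow> 'a::comm_ring_1"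
  shows "(z - R) * (\<Sum>k\<le>m. a k * z ^ k) =
         a m * z ^ Suc m - ((\<Sum>k<m. (R * a (Suc k) - a k) * z ^ Suc k) + R * a 0)"
  by (induction m) (simp_all add: algebra_simps)

text \<open>If the modulus \<open>r\<close> of a root exceeded \<open>R\<close>, the triangle
  inequality in the identity at \<open>z\<close>, compared with the identity at \<open>r\<close>,
  would give \<open>(r - R) * (\<Sum>k\<le>m. a k * r ^ k) \<le> 0\<close>, although both factors
  are positive.\<close>

lemma enestroem_kakeya:
  fixes a :: "nat \<Rightarrow> real" and z :: complex
  assumes nonneg: "\<And>k. 0 \<le> a k" and lead: "0 < a m" and "0 \<le> R"
    and ratio: "\<And>k. k < m \<Longrightarrow> a k \<le> R * a (Suc k)"
    and root: "(\<Sum>k\<le>m. of_real (a k) * z ^ k) = 0"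
  shows "cmod z \<le> R"
proof (rule ccontr)
  assume "\<not> cmod z \<le> R"
  define r where "r = cmod z"
  have r: "R < r" "0 < r" using \<open>\<not> cmod z \<le> R\<close> \<open>0 \<le> R\<close> by (auto simp: r_def)
  have "of_real (a m) * z ^ Suc m =
      (\<Sum>k<m. of_real (R * a (Suc k) - a k) * z ^ Suc k) + of_real (R * a 0)"
    using enestroem_kakeya_identity[of z "of_real R" "\<lambda>k. of_real (a k)" m] root by simp
  then have "a m * r ^ Suc m =
      cmod ((\<Sum>k<m. of_real (R * a (Suc k) - a k) * z ^ Suc k) + of_real (R * a 0))"
    using lead by (metis abs_of_pos norm_mult norm_of_real norm_power r_def)
  also have "\<dots> \<le> (\<Sum>k<m. cmod (of_real (R * a (Suc k) - a k) * z ^ Suc k)) + cmod (of_real (R * a 0))"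
    by (intro order_trans[OF norm_triangle_ineq] add_right_mono norm_sum)
  \<comment> \<open>By \<open>ratio\<close> and \<open>nonneg\<close> every coefficient is
    nonnegative, so taking moduli only replaces \<open>z\<close> by \<open>r\<close>.\<close>
  also have "\<dots> = (\<Sum>k<m. (R * a (Suc k) - a k) * r ^ Suc k) + R * a 0"
    using ratio nonneg[of 0] \<open>0 \<le> R\<close>
    by (simp add: norm_mult norm_power r_def abs_mult flip: of_real_mult of_real_diff)
  also have "\<dots> = a m * r ^ Suc m - (r - R) * (\<Sum>k\<le>m. a k * r ^ k)"
    using enestroem_kakeya_identity[of r R a m] by simp
  finally have "(r - R) * (\<Sum>k\<le>m. a k * r ^ k) \<le> 0" by simp
  moreover have "0 < (\<Sum>k\<le>m. a k * r ^ k)"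
    using r lead nonneg by (intro sum_pos2[where i = m]) auto
  ultimately show False
    using r by (simp add: mult_le_0_iff)
qed

section \<open>Distances and the pairs of vertices at a given distance\<close>

text \<open>Distances minimise over paths, yet prolonging a path by an arc may only give a walk.
  Removing cycles only discards arcs, and a path repeats no arc, so its length is the size of its
  arc set.\<close>

lemma (in wf_digraph) awalk_imp_apath_length_le:
  assumes "awalk u p v"
  obtains q where "apath u q v" "length q \<le> length p"
proof
  let ?q = "awalk_to_apath p"
  show q: "apath u ?q v" using assms by (rule apath_awalk_to_apath)
  have "length ?q = card (set ?q)"
    using q by (auto simp: apath_def distinct_card dest: distinct_verts_imp_distinct)
  also have "\<dots> \<le> length p"
    using awalk_to_apath_subset[OF assms] by (meson List.finite_set card_length card_mono le_trans)
  finally show "length ?q \<le> length p" .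
qed

text \<open>The fibres of \<open>pair_dist\<close>; their sizes are the coefficients
  \<open>c\<^sub>k\<close>.\<close>

definition pairs_at_dist :: "'a pair_pre_digraph \<Rightarrow> nat \<Rightarrow> 'a set set" where
  "pairs_at_dist G k = {e. e \<subseteq> pverts G \<and> card e = 2 \<and> pair_dist G e = k}"

context pair_graph
begin

lemma doubleton_in_pairs_at_dist:
  "{u, v} \<in> pairs_at_dist G k \<longleftrightarrow>
     u \<in> pverts G \<and> v \<in> pverts G \<and> u \<noteq> v \<and> graph_dist G u v = k"
  by (auto simp: pairs_at_dist_def pair_dist_doubleton[OF pair_graph] card_insert_if)

lemma pairs_at_distE:
  assumes "e \<in> pairs_at_dist G k"
  obtains u v where "e = {u, v}" "u \<in> pverts G" "v \<in> pverts G" "u \<noteq> v" "graph_dist G u v = k"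
proof -
  obtain u v where "e = {u, v}" using assms by (auto simp: pairs_at_dist_def card_2_iff)
  then show ?thesis using that assms by (simp add: doubleton_in_pairs_at_dist)
qed

lemma finite_pairs_at_dist: "finite (pairs_at_dist G k)"
  by (rule finite_subset[of _ "Pow (pverts G)"]) (auto simp: pairs_at_dist_def pair_finite_verts)

lemma card_pairs_at_dist_pos: "0 < card (pairs_at_dist G k) \<longleftrightarrow> pairs_at_dist G k \<noteq> {}"
  by (simp add: card_gt_0_iff finite_pairs_at_dist)

text \<open>Fibres of different distances are disjoint families of two-element vertex sets. The
  counts are later compared for two or three distances at a time.\<close>

lemma sum_card_pairs_at_dist_le:
  assumes "finite K"
  shows "(\<Sum>k\<in>K. card (pairs_at_dist G k)) \<le> card (pverts G) choose 2"
proof -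
  have "(\<Sum>k\<in>K. card (pairs_at_dist G k)) = card (\<Union>k\<in>K. pairs_at_dist G k)"
    by (rule card_UN_disjoint[symmetric])
      (use assms finite_pairs_at_dist in \<open>auto simp: pairs_at_dist_def\<close>)
  also have "\<dots> \<le> card {e. e \<subseteq> pverts G \<and> card e = 2}"
    by (rule card_mono) (auto simp: pairs_at_dist_def pair_finite_verts)
  finally show ?thesis by (simp add: n_subsets pair_finite_verts)
qed

lemma coeff_wiener_poly: "coeff (wiener_poly G) k = of_nat (card (pairs_at_dist G k))"
proof -
  have fin: "finite {e. e \<subseteq> pverts G \<and> card e = 2}"
    by (simp add: pair_finite_verts)
  have "coeff (wiener_poly G) k =
      of_nat (card ({e. e \<subseteq> pverts G \<and> card e = 2} \<inter> {e. pair_dist G e = k}))"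
    unfolding wiener_poly_def by (simp add: coeff_sum fin sum.If_cases)
  also have "{e. e \<subseteq> pverts G \<and> card e = 2} \<inter> {e. pair_dist G e = k} = pairs_at_dist G k"
    by (auto simp: pairs_at_dist_def)
  finally show ?thesis .
qed

lemma graph_dist_le: "apath u p v \<Longrightarrow> graph_dist G u v \<le> length p"
  unfolding graph_dist_def by (rule Least_le) blast

lemma graph_dist_eq_1:
  assumes "(u, v) \<in> parcs G"
  shows "graph_dist G u v = 1"
  unfolding graph_dist_def
proof (rule Least_equality)
  have "apath u [(u, v)] v"
    using assms by (auto simp: apath_simps no_loops' dest: in_arcsD2 no_loops')
  then show "\<exists>p. apath u p v \<and> length p = 1" by (intro exI) auto
next
  fix k assume "\<exists>p. apath u p v \<and> length p = k"
  then show "1 \<le> k"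
    using no_loops'[OF assms] by (cases k) (auto simp: apath_simps)
qed

end

section \<open>Distances in connected graphs\<close>

locale connected_pair_graph = pair_graph +
  assumes connected_G: "Digraph_Component.connected (with_proj G)"
begin

lemma ex_apath:
  assumes "u \<in> pverts G" "v \<in> pverts G"
  obtains p where "apath u p v" "length p = graph_dist G u v"
proof -
  \<comment> \<open>Connectedness refers to the symmetric closure; as the arcs are symmetric
    already, directed reachability follows.\<close>
  have "strongly_connected (with_proj G)"
    using symmetric_connected_imp_strongly_connected sym_arcs connected_G by blast
  then have "u \<rightarrow>\<^sup>*\<^bsub>with_proj G\<^esub> v" using assms by (auto simp: strongly_connected_def)
  then have "\<exists>k p. apath u p v \<and> length p = k" by (auto simp: reachable_apath)
  then have "\<exists>p. apath u p v \<and> length p = graph_dist G u v"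
    unfolding graph_dist_def by (rule LeastI_ex)
  then show ?thesis using that by blast
qed

lemma graph_dist_eq_0D:
  assumes "u \<in> pverts G" "v \<in> pverts G" "graph_dist G u v = 0"
  shows "u = v"
  by (rule ex_apath[OF assms(1,2)]) (use assms in \<open>auto simp: apath_simps\<close>)

lemma graph_dist_eq_1D:
  assumes "u \<in> pverts G" "v \<in> pverts G" "graph_dist G u v = 1"
  shows "(u, v) \<in> parcs G"
  by (rule ex_apath[OF assms(1,2)])
    (use assms in \<open>auto simp: apath_simps length_Suc_conv\<close>)

lemma pairs_at_dist_0: "pairs_at_dist G 0 = {}"
  by (auto elim!: pairs_at_distE dest: graph_dist_eq_0D)

text \<open>Dropping the first arc of a shortest path leaves a shortest path: a shorter one from the
  second vertex would, with that arc put back, beat the original.\<close>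

lemma pairs_at_dist_Suc_neq_empty:
  assumes "pairs_at_dist G (Suc (Suc k)) \<noteq> {}"
  shows "pairs_at_dist G (Suc k) \<noteq> {}"
proof -
  obtain e where "e \<in> pairs_at_dist G (Suc (Suc k))" using assms by blast
  then obtain u v where uv: "u \<in> pverts G" "v \<in> pverts G" "graph_dist G u v = Suc (Suc k)"
    by (rule pairs_at_distE)
  obtain e p where p: "apath u (e # p) v" "length p = Suc k"
    using ex_apath[OF uv(1,2)] uv(3) by (metis length_Suc_conv)
  let ?w = "snd e"
  have wv: "apath ?w p v" and e: "e \<in> parcs G" "fst e = u" using p by (auto simp: apath_simps)
  have w: "?w \<in> pverts G" using e by (auto intro: arc_snd_in_verts)
  obtain q where q: "apath ?w q v" "length q = graph_dist G ?w v"
    using ex_apath[OF w uv(2)] .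
  \<comment> \<open>\<open>q\<close> may pass through \<open>u\<close>, so this is only a walk and
    must be cut down to a path before it can be compared with the distance.\<close>
  have "awalk u (e # q) v" using q(1) e by (auto simp: awalk_Cons_iff awalkI_apath)
  then obtain s where s: "apath u s v" "length s \<le> length (e # q)"
    by (rule awalk_imp_apath_length_le)
  then have "Suc k \<le> graph_dist G ?w v" using graph_dist_le[OF s(1)] uv(3) q(2) by simp
  moreover have "graph_dist G ?w v \<le> Suc k" using graph_dist_le[OF wv] p(2) by simp
  \<comment> \<open>The remaining path has length \<open>Suc k\<close>, hence is nonempty, and a
    nonempty path has distinct ends.\<close>
  moreover have "?w \<noteq> v" using wv p(2) apath_nonempty_ends[of ?w p v] by (cases p) auto
  ultimately have "{?w, v} \<in> pairs_at_dist G (Suc k)"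
    using w uv by (simp add: doubleton_in_pairs_at_dist)
  then show ?thesis by blast
qed

text \<open>Repeated descent by one distance, stopping at 1. It excludes vanishing coefficients
  between the constant and the leading one, where a ratio bound could fail.\<close>

lemma pairs_at_dist_downward:
  assumes "pairs_at_dist G k \<noteq> {}" "0 < j" "j \<le> k"
  shows "pairs_at_dist G j \<noteq> {}"
  using assms(3,1,2)
proof (induction rule: inc_induct)
  case (step i)
  then show ?case using pairs_at_dist_Suc_neq_empty by (cases i) auto
qed

section \<open>Root bounds and the extremal counts\<close>

lemma wiener_poly_neq_0:
  assumes "2 \<le> card (pverts G)"
  shows "wiener_poly G \<noteq> 0"
proof -
  obtain e where "e \<subseteq> pverts G" "card e = 2"
    using assms by (metis obtain_subset_with_card_n)
  then have "pairs_at_dist G (pair_dist G e) \<noteq> {}" by (auto simp: pairs_at_dist_def)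
  then have "coeff (wiener_poly G) (pair_dist G e) \<noteq> 0"
    using finite_pairs_at_dist by (simp add: coeff_wiener_poly)
  then show ?thesis by auto
qed

text \<open>Enestroem-Kakeya applied to the counts. Ratios need bounding only where the later count
  is nonzero, since every distance from 1 up to the degree occurs.\<close>

lemma cmod_wiener_root_le:
  assumes "2 \<le> card (pverts G)" "z \<in> wiener_roots G"
    and "\<And>k. pairs_at_dist G (Suc k) \<noteq> {} \<Longrightarrow>
           real (card (pairs_at_dist G k)) \<le> R * real (card (pairs_at_dist G (Suc k)))"
    and "0 \<le> R"
  shows "cmod z \<le> R"
proof (rule enestroem_kakeya[where a = "\<lambda>k. real (card (pairs_at_dist G k))"
      and m = "degree (wiener_poly G)"])
  let ?m = "degree (wiener_poly G)"
  have "coeff (wiener_poly G) ?m \<noteq> 0" using wiener_poly_neq_0[OF assms(1)] by simp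
  then have m: "pairs_at_dist G ?m \<noteq> {}" by (auto simp: coeff_wiener_poly)
  then show "0 < real (card (pairs_at_dist G ?m))" by (simp add: card_pairs_at_dist_pos)
  \<comment> \<open>\<open>Suc k\<close> is positive even for \<open>k = 0\<close>, so the vanishing
    constant coefficient is no exception.\<close>
  show "real (card (pairs_at_dist G k)) \<le> R * real (card (pairs_at_dist G (Suc k)))" if "k < ?m" for k
    using assms(3) pairs_at_dist_downward[OF m] that by simp
  show "(\<Sum>k\<le>?m. of_real (real (card (pairs_at_dist G k))) * z ^ k) = 0"
    using assms(2) by (simp add: wiener_roots_def poly_altdef coeff_wiener_poly)
qed (use assms in auto)

lemma card_pairs_at_dist_consecutive_le:
  "card (pairs_at_dist G k) + card (pairs_at_dist G (Suc k)) \<le> card (pverts G) choose 2"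
  using sum_card_pairs_at_dist_le[of "{k, Suc k}"] by simp

lemma cmod_wiener_root_le_choose:
  assumes "2 \<le> card (pverts G)" "z \<in> wiener_roots G"
  shows "cmod z \<le> real (card (pverts G) choose 2) - 1"
proof (rule cmod_wiener_root_le[OF assms])
  let ?N = "card (pverts G) choose 2"
  have N: "1 \<le> ?N" using assms(1) by (simp add: Suc_leI)
  then show "0 \<le> real ?N - 1" by simp
  fix k assume "pairs_at_dist G (Suc k) \<noteq> {}"
  then have c: "1 \<le> card (pairs_at_dist G (Suc k))" using card_pairs_at_dist_pos by (simp add: Suc_leI)
  \<comment> \<open>At least one pair lies at the later distance, leaving at most
    \<open>?N - 1\<close> for distance \<open>k\<close>.\<close>
  then have "card (pairs_at_dist G k) + 1 \<le> ?N"
    using card_pairs_at_dist_consecutive_le[of k] by linarith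
  then have "real (card (pairs_at_dist G k)) \<le> (real ?N - 1) * 1"
    by (simp only: le_diff_eq mult_1_right)
  also have "\<dots> \<le> (real ?N - 1) * real (card (pairs_at_dist G (Suc k)))"
    using c N by (intro mult_left_mono) auto
  finally show "real (card (pairs_at_dist G k)) \<le> \<dots>" .
qed

lemma extremal_wiener_root:
  assumes "3 \<le> card (pverts G)" "z \<in> wiener_roots G"
    and "cmod z = real (card (pverts G) choose 2) - 1"
  shows "card (pairs_at_dist G 2) = 1 \<and> card (pairs_at_dist G 1) = (card (pverts G) choose 2) - 1"
proof -
  let ?N = "card (pverts G) choose 2" and ?c = "\<lambda>k. card (pairs_at_dist G k)"
  have N: "3 \<le> ?N" using binomial_right_mono[OF assms(1), of 2] by (simp add: choose_two)
  \<comment> \<open>Otherwise \<open>?N - 2\<close> would be an admissible ratio bound, which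
    \<open>cmod z\<close> exceeds.\<close>
  have "\<exists>k. pairs_at_dist G (Suc k) \<noteq> {} \<and> (real ?N - 2) * ?c (Suc k) < ?c k"
  proof (rule ccontr)
    assume *: "\<not> ?thesis"
    have "cmod z \<le> real ?N - 2"
      by (rule cmod_wiener_root_le) (use * assms N in \<open>auto simp: not_less\<close>)
    then show False using assms(3) by simp
  qed
  then obtain k where k: "pairs_at_dist G (Suc k) \<noteq> {}" "(real ?N - 2) * ?c (Suc k) < ?c k" by blast
  have pos: "1 \<le> ?c (Suc k)" using k(1) card_pairs_at_dist_pos by (simp add: Suc_leI)
  have "(real ?N - 2) * 1 \<le> (real ?N - 2) * ?c (Suc k)"
    using pos N by (intro mult_left_mono) auto
  then have "real ?N < real (?c k + 2)" using k(2) by simp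
  \<comment> \<open>Between integers strictness gives \<open>?c k \<ge> ?N - 1\<close>, which leaves
    room for only one pair at distance \<open>Suc k\<close>.\<close>
  then have "?N < ?c k + 2" by (simp only: of_nat_less_iff)
  then have c: "?c (Suc k) = 1" "?c k = ?N - 1"
    using pos card_pairs_at_dist_consecutive_le[of k] by linarith+
  \<comment> \<open>\<open>?c 0\<close> is 0, whereas \<open>?N - 1\<close> is at least 2.\<close>
  have "k \<noteq> 0" using c N by (intro notI) (simp add: pairs_at_dist_0)
  \<comment> \<open>For larger \<open>k\<close>, distance 1 would occur in addition to two distances
    that use up all pairs.\<close>
  moreover have "\<not> 1 < k"
  proof
    assume "1 < k"
    then have "?c 1 + ?c k + ?c (Suc k) \<le> ?N"
      using sum_card_pairs_at_dist_le[of "{1, k, Suc k}"] by simp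
    then have "?c 1 = 0" using c N by linarith
    moreover have "0 < ?c 1"
      using pairs_at_dist_downward[OF k(1), of 1] by (simp add: card_pairs_at_dist_pos)
    ultimately show False by simp
  qed
  ultimately have "k = 1" by simp
  then show ?thesis using c by (simp add: numeral_2_eq_2)
qed

text \<open>The two counts exhaust all pairs, so no third distance occurs and the only nonadjacent
  pair is the one at distance 2.\<close>

lemma arcs_if_card_pairs_at_dist:
  assumes "card (pairs_at_dist G 2) = 1"
    and "card (pairs_at_dist G 1) = (card (pverts G) choose 2) - 1"
  obtains a b where "a \<in> pverts G" "b \<in> pverts G" "a \<noteq> b"
    and "parcs G = {(u, v). u \<in> pverts G \<and> v \<in> pverts G \<and> u \<noteq> v} - {(a, b), (b, a)}"
proof -
  obtain e where e: "pairs_at_dist G 2 = {e}" using assms(1) by (auto simp: card_1_singleton_iff)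
  then obtain a b where ab: "e = {a, b}" "a \<in> pverts G" "b \<in> pverts G" "a \<noteq> b" "graph_dist G a b = 2"
    by (metis insertI1 pairs_at_distE)
  have "(u, v) \<in> parcs G" if "u \<in> pverts G" "v \<in> pverts G" "u \<noteq> v" "{u, v} \<noteq> {a, b}" for u v
  proof (rule ccontr)
    assume "(u, v) \<notin> parcs G"
    let ?d = "graph_dist G u v"
    have d: "?d \<noteq> 1" "?d \<noteq> 2"
      using graph_dist_eq_1D[OF that(1,2)] \<open>(u, v) \<notin> parcs G\<close> e ab(1) that
        doubleton_in_pairs_at_dist[of u v 2] by auto
    \<comment> \<open>A third distance \<open>?d\<close> would add a pair to two counts that already
      reach the total.\<close>
    have "0 < card (pairs_at_dist G ?d)"
      using that doubleton_in_pairs_at_dist[of u v ?d] card_pairs_at_dist_pos by blast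
    then show False
      using sum_card_pairs_at_dist_le[of "{?d, 1, 2}"] assms d by simp
  qed
  moreover have "(a, b) \<notin> parcs G" "(b, a) \<notin> parcs G"
    using ab(5) graph_dist_eq_1[of a b] arcs_symmetric[of b a] by auto
  ultimately have "parcs G = {(u, v). u \<in> pverts G \<and> v \<in> pverts G \<and> u \<noteq> v} - {(a, b), (b, a)}"
    by (auto simp: doubleton_eq_iff dest: in_arcsD1 in_arcsD2 no_loops')
  then show ?thesis using that ab by blast
qed

end

lemma connected_graph_of_order_iff:
  "connected_graph_of_order n G \<longleftrightarrow> connected_pair_graph G \<and> card (pverts G) = n"
  by (auto simp: connected_graph_of_order_def connected_pair_graph_def connected_pair_graph_axioms_def)

section \<open>Isomorphism with \<open>complete_graph_minus_edge\<close>\<close>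

text \<open>The ends of the missing edge must go to 0 and 1, where
  \<open>complete_graph_minus_edge\<close> lacks its edge; the other vertices are matched
  arbitrarily with the remaining numbers.\<close>

lemma ex_bij_betw_lessThan_two_points:
  assumes "finite V" "a \<in> V" "b \<in> V" "a \<noteq> b"
  obtains f :: "'a \<Rightarrow> nat" where "bij_betw f V {..<card V}" "f a = 0" "f b = 1"
proof -
  have "card {a, b} \<le> card V" using assms by (intro card_mono) auto
  then have "card (V - {a, b}) = card {2..<card V}"
    using assms by (simp add: card_Diff_subset)
  then obtain g where g: "bij_betw g (V - {a, b}) {2..<card V}"
    using assms by (meson finite_Diff finite_atLeastLessThan finite_same_card_bij)
  have "bij_betw (g(a := 0, b := 1)) ((V - {a, b}) \<union> {a, b}) ({2..<card V} \<union> {0, 1})"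
  proof (rule bij_betw_combine)
    show "bij_betw (g(a := 0, b := 1)) (V - {a, b}) {2..<card V}"
      using g by (rule bij_betw_cong[THEN iffD1, rotated]) auto
    show "bij_betw (g(a := 0, b := 1)) {a, b} {0, 1}"
      using assms by (auto simp: bij_betw_def inj_on_def)
  qed auto
  moreover have "(V - {a, b}) \<union> {a, b} = V" "{2..<card V} \<union> {0, 1} = {..<card V}"
    using assms \<open>card {a, b} \<le> card V\<close> by auto
  ultimately show ?thesis using that[of "g(a := 0, b := 1)"] assms by auto
qed

text \<open>In a pair digraph an arc is its pair of ends, so the vertex map determines the arc map
  \<open>map_prod f f\<close>, and tail and head stay \<open>fst\<close> and
  \<open>snd\<close>.\<close>

lemma digraph_iso_pairI:
  assumes "pair_wf_digraph G" "inj_on f (pverts G)"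
    and "pverts H = f ` pverts G" "parcs H = map_prod f f ` parcs G"
  shows "digraph_iso (with_proj G) (with_proj H)"
proof -
  interpret pair_wf_digraph G by fact
  let ?h = "\<lparr>iso_verts = f, iso_arcs = map_prod f f, iso_head = snd, iso_tail = fst\<rparr>"
  have "inj_on (map_prod f f) (parcs G)"
    by (rule inj_on_subset[OF map_prod_inj_on[OF assms(2,2)]]) (auto dest: in_arcsD1 in_arcsD2)
  then have "digraph_isomorphism ?h"
    using assms(2) wf_digraph by (auto simp: digraph_isomorphism_def)
  moreover have "with_proj H = app_iso ?h (with_proj G)"
    using assms(3,4) by (simp add: with_proj_def app_iso_def)
  ultimately show ?thesis unfolding digraph_iso_def by blast
qed

lemma complete_graph_minus_edge_simps:
  "pverts (complete_graph_minus_edge n) = {..<n}"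
  "parcs (complete_graph_minus_edge n) =
     {(u, v). u < n \<and> v < n \<and> u \<noteq> v} - {(0, 1), (1, 0)}"
  by (simp_all add: complete_graph_minus_edge_def del_edge_def complete_graph_def)

lemma digraph_iso_complete_graph_minus_edge:
  assumes "pair_graph G" "a \<in> pverts G" "b \<in> pverts G" "a \<noteq> b"
    and "parcs G = {(u, v). u \<in> pverts G \<and> v \<in> pverts G \<and> u \<noteq> v} - {(a, b), (b, a)}"
  shows "digraph_iso (with_proj G) (with_proj (complete_graph_minus_edge (card (pverts G))))"
proof -
  interpret pair_graph G by fact
  obtain f :: "'a \<Rightarrow> nat" where f: "bij_betw f (pverts G) {..<card (pverts G)}" "f a = 0" "f b = 1"
    using ex_bij_betw_lessThan_two_points[OF pair_finite_verts assms(2-4)] .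
  have inj: "inj_on f (pverts G)" and im: "f ` pverts G = {..<card (pverts G)}"
    using f(1) by (auto simp: bij_betw_def)
  have mem: "(f u, f v) \<in> parcs (complete_graph_minus_edge (card (pverts G))) \<longleftrightarrow> (u, v) \<in> parcs G"
    if "u \<in> pverts G" "v \<in> pverts G" for u v
  proof -
    \<comment> \<open>Injectivity turns tests of images against 0 and 1 into tests of vertices
      against \<open>a\<close> and \<open>b\<close>, so both arc sets obey the same
      condition.\<close>
    have "f u = f a \<longleftrightarrow> u = a" "f u = f b \<longleftrightarrow> u = b" "f v = f a \<longleftrightarrow> v = a" "f v = f b \<longleftrightarrow> v = b"
      "f u = f v \<longleftrightarrow> u = v" "f u < card (pverts G)" "f v < card (pverts G)"
      using that assms(2,3) inj im by (auto simp: inj_on_eq_iff)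
    then show ?thesis
      using that f(2,3) by (simp add: complete_graph_minus_edge_simps assms(5))
  qed
  have "x \<in> map_prod f f ` parcs G" if "x \<in> parcs (complete_graph_minus_edge (card (pverts G)))" for x
  proof -
    obtain i j where x: "x = (i, j)" by force
    then have "i \<in> f ` pverts G" "j \<in> f ` pverts G"
      using that im by (auto simp: complete_graph_minus_edge_simps)
    then obtain u v where uv: "i = f u" "j = f v" "u \<in> pverts G" "v \<in> pverts G" by auto
    then have "(u, v) \<in> parcs G" using mem that x by auto
    then show ?thesis using uv x by force
  qed
  moreover have "x \<in> parcs (complete_graph_minus_edge (card (pverts G)))" if "x \<in> map_prod f f ` parcs G" for x
    using that mem by (auto dest: in_arcsD1 in_arcsD2)
  ultimately have "parcs (complete_graph_minus_edge (card (pverts G))) = map_prod f f ` parcs G"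
    by blast
  then show ?thesis
    using inj im by (intro digraph_iso_pairI pair_wf_digraph) (auto simp: complete_graph_minus_edge_simps)
qed

section \<open>The complete graph with and without an edge\<close>

text \<open>Walks of at most two arcs join all vertices; diameter at most two is all that the two
  concrete families need.\<close>

lemma connected_pair_graphI:
  assumes "pair_graph G" "pverts G \<noteq> {}"
    and "\<And>u v. u \<in> pverts G \<Longrightarrow> v \<in> pverts G \<Longrightarrow> u \<noteq> v \<Longrightarrow>
           (u, v) \<notin> parcs G \<Longrightarrow> \<exists>w. (u, w) \<in> parcs G \<and> (w, v) \<in> parcs G"
  shows "connected_pair_graph G"
proof -
  interpret pair_graph G by fact
  have "u \<rightarrow>\<^sup>*\<^bsub>with_proj G\<^esub> v" if uv: "u \<in> pverts G" "v \<in> pverts G" for u v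
  proof (cases "u = v")
    case False
    then consider "(u, v) \<in> parcs G" | w where "(u, w) \<in> parcs G" "(w, v) \<in> parcs G"
      using assms(3) uv by blast
    then show ?thesis
      by cases (metis adj_reachable_trans reachable_adjI with_proj_simps(3))+
  qed (use uv in auto)
  then have "Digraph_Component.connected (with_proj G)"
    using assms(2) by (intro connectedI) (auto intro: reachable_mk_symmetricI)
  then show ?thesis by unfold_locales
qed

lemma connected_pair_graph_complete_graph:
  assumes "0 < n"
  shows "connected_pair_graph (complete_graph n)"
proof (rule connected_pair_graphI)
  have "finite (parcs (complete_graph n))"
    by (rule finite_subset[of _ "{..<n} \<times> {..<n}"]) (auto simp: complete_graph_def)
  then show "pair_graph (complete_graph n)"
    by unfold_locales (auto simp: complete_graph_def symmetric_def sym_def)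
qed (use assms in \<open>auto simp: complete_graph_def\<close>)

lemma connected_pair_graph_complete_graph_minus_edge:
  assumes "3 \<le> n"
  shows "connected_pair_graph (complete_graph_minus_edge n)"
proof (rule connected_pair_graphI)
  have "finite (parcs (complete_graph_minus_edge n))"
    by (rule finite_subset[of _ "{..<n} \<times> {..<n}"]) (auto simp: complete_graph_minus_edge_simps)
  then show "pair_graph (complete_graph_minus_edge n)"
    by unfold_locales (auto simp: complete_graph_minus_edge_simps symmetric_def sym_def)
  fix u v
  assume "u \<in> pverts (complete_graph_minus_edge n)" "v \<in> pverts (complete_graph_minus_edge n)"
    "u \<noteq> v" "(u, v) \<notin> parcs (complete_graph_minus_edge n)"
  \<comment> \<open>Only 0 and 1 are distinct and nonadjacent; their common neighbour 2 exists
    because \<open>n\<close> is at least 3.\<close>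
  then show "\<exists>w. (u, w) \<in> parcs (complete_graph_minus_edge n) \<and> (w, v) \<in> parcs (complete_graph_minus_edge n)"
    using assms by (intro exI[of _ 2]) (auto simp: complete_graph_minus_edge_simps)
qed (use assms in \<open>auto simp: complete_graph_minus_edge_simps lessThan_empty_iff\<close>)

text \<open>Every pair other than \<open>{0, 1}\<close> is adjacent, and 0 and 1 are joined through
  2.\<close>

lemma wiener_poly_complete_graph_minus_edge:
  assumes "3 \<le> n"
  shows "wiener_poly (complete_graph_minus_edge n) = monom (of_nat ((n choose 2) - 1)) 1 + monom 1 2"
proof -
  let ?G = "complete_graph_minus_edge n" and ?P = "{e. e \<subseteq> {..<n} \<and> card e = 2}"
  interpret connected_pair_graph ?G
    using connected_pair_graph_complete_graph_minus_edge[OF assms] .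
  have "graph_dist ?G 0 1 \<le> 2"
  proof -
    have "apath 0 [(0, 2), (2, 1)] 1"
      using assms by (auto simp: apath_simps complete_graph_minus_edge_simps)
    then show ?thesis using graph_dist_le by fastforce
  qed
  moreover have "graph_dist ?G 0 1 \<noteq> 0" "graph_dist ?G 0 1 \<noteq> 1"
    using graph_dist_eq_0D[of 0 1] graph_dist_eq_1D[of 0 1] assms
    by (auto simp: complete_graph_minus_edge_simps)
  ultimately have d: "pair_dist ?G {0, 1} = 2" by (simp add: pair_dist_doubleton[OF pair_graph])
  have one: "pair_dist ?G e = 1" if e: "e \<in> ?P - {{0, 1}}" for e
  proof -
    obtain u v where uv: "e = {u, v}" "u \<noteq> v"
      using e by (auto simp: card_2_iff)
    then have "u < n" "v < n" "{u, v} \<noteq> {0, 1}"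
      using e by auto
    then have "(u, v) \<in> parcs ?G"
      using uv(2) by (auto simp: complete_graph_minus_edge_simps)
    then show ?thesis
      using graph_dist_eq_1 uv(1) by (simp add: pair_dist_doubleton[OF pair_graph])
  qed
  have P: "finite ?P" "{0, 1} \<in> ?P" using assms by auto
  have "wiener_poly ?G = (\<Sum>e\<in>?P. monom 1 (pair_dist ?G e))"
    by (simp add: wiener_poly_def complete_graph_minus_edge_simps)
  also have "\<dots> = monom 1 2 + (\<Sum>e\<in>?P - {{0, 1}}. monom 1 (pair_dist ?G e))"
    using d by (simp add: sum.remove[OF P])
  also have "(\<Sum>e\<in>?P - {{0, 1}}. monom (1::complex) (pair_dist ?G e)) = (\<Sum>e\<in>?P - {{0, 1}}. monom 1 1)"
    by (rule sum.cong) (simp_all only: one)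
  also have "\<dots> = monom (of_nat ((n choose 2) - 1)) 1"
    using P by (simp add: card_Diff_singleton n_subsets smult_monom of_nat_poly)
  finally show ?thesis by (simp add: add.commute)
qed

text \<open>The polynomial factors as \<open>x * (x + ((n choose 2) - 1))\<close>.\<close>

lemma wiener_root_complete_graph_minus_edge:
  assumes "3 \<le> n"
  shows "- of_nat ((n choose 2) - 1) \<in> wiener_roots (complete_graph_minus_edge n)"
  by (simp add: wiener_roots_def wiener_poly_complete_graph_minus_edge[OF assms] poly_monom power2_eq_square)

text \<open>No pair has distance 0, hence there is no constant term. For order 2 this root attains
  the bound, which is then 0.\<close>

lemma (in connected_pair_graph) zero_in_wiener_roots: "0 \<in> wiener_roots G"
  by (simp add: wiener_roots_def poly_0_coeff_0 coeff_wiener_poly pairs_at_dist_0)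

theorem theorem2:
  fixes n :: nat
  assumes "n \<ge> 2"
  shows "(\<forall>(G :: 'a pair_pre_digraph) z.
            connected_graph_of_order n G \<and> z \<in> wiener_roots G
              \<longrightarrow> cmod z \<le> real (n choose 2) - 1) \<and>
         (\<exists>(G :: nat pair_pre_digraph) z.
            connected_graph_of_order n G \<and> z \<in> wiener_roots G
              \<and> cmod z = real (n choose 2) - 1) \<and>
         (n \<ge> 3 \<longrightarrow>
            connected_graph_of_order n (complete_graph_minus_edge n) \<and>
            (\<exists>z \<in> wiener_roots (complete_graph_minus_edge n). cmod z = real (n choose 2) - 1) \<and>
            (\<forall>G :: 'a pair_pre_digraph.
               connected_graph_of_order n G \<and>
               (\<exists>z \<in> wiener_roots G. cmod z = real (n choose 2) - 1)
                 \<longrightarrow> digraph_iso (with_proj G) (with_proj (complete_graph_minus_edge n))))"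
proof (intro conjI impI allI)
  have attained: "connected_graph_of_order n (complete_graph_minus_edge n) \<and>
      (\<exists>z \<in> wiener_roots (complete_graph_minus_edge n). cmod z = real (n choose 2) - 1)" if "3 \<le> n"
  proof
    show "connected_graph_of_order n (complete_graph_minus_edge n)"
      using connected_pair_graph_complete_graph_minus_edge[OF that]
      by (simp add: connected_graph_of_order_iff complete_graph_minus_edge_simps)
    \<comment> \<open>Makes subtraction on naturals agree with subtraction on reals.\<close>
    have "1 \<le> n choose 2" using that by (simp add: Suc_leI)
    then have "cmod (- of_nat ((n choose 2) - 1)) = real (n choose 2) - 1"
      by (simp only: norm_minus_cancel norm_of_nat)
    then show "\<exists>z \<in> wiener_roots (complete_graph_minus_edge n). cmod z = real (n choose 2) - 1"
      using wiener_root_complete_graph_minus_edge[OF that] by blast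
  qed
  show "cmod z \<le> real (n choose 2) - 1"
    if "connected_graph_of_order n G \<and> z \<in> wiener_roots G" for G :: "'a pair_pre_digraph" and z
    using that connected_pair_graph.cmod_wiener_root_le_choose[of G z] assms
    by (auto simp: connected_graph_of_order_iff)
  show "\<exists>(G :: nat pair_pre_digraph) z. connected_graph_of_order n G \<and> z \<in> wiener_roots G \<and>
      cmod z = real (n choose 2) - 1"
  proof (cases "n = 2")
    \<comment> \<open>Removing the only edge would disconnect the graph, so here the complete graph
      itself attains the bound 0, with the root 0.\<close>
    case True
    have "connected_pair_graph (complete_graph n)"
      using assms by (intro connected_pair_graph_complete_graph) simp
    then have "connected_graph_of_order n (complete_graph n)" "0 \<in> wiener_roots (complete_graph n)"
      by (auto simp: connected_graph_of_order_iff complete_graph_def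
          intro: connected_pair_graph.zero_in_wiener_roots)
    then show ?thesis using True by force
  next
    case False
    then have "3 \<le> n" using assms by simp
    then show ?thesis using attained by blast
  qed
  assume n: "3 \<le> n"
  then show "connected_graph_of_order n (complete_graph_minus_edge n)"
    and "\<exists>z \<in> wiener_roots (complete_graph_minus_edge n). cmod z = real (n choose 2) - 1"
    using attained by auto
  fix G :: "'a pair_pre_digraph"
  assume G: "connected_graph_of_order n G \<and> (\<exists>z \<in> wiener_roots G. cmod z = real (n choose 2) - 1)"
  then interpret connected_pair_graph G by (simp add: connected_graph_of_order_iff)
  have order: "card (pverts G) = n" using G by (simp add: connected_graph_of_order_iff)
  obtain z where "z \<in> wiener_roots G" "cmod z = real (n choose 2) - 1" using G by blast
  \<comment> \<open>The modulus fixes the counts, the counts fix the arcs, and the arcs fix the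
    graph up to isomorphism.\<close>
  then have "card (pairs_at_dist G 2) = 1"
    and "card (pairs_at_dist G 1) = (card (pverts G) choose 2) - 1"
    using extremal_wiener_root n order by auto
  then obtain a b where "a \<in> pverts G" "b \<in> pverts G" "a \<noteq> b"
    and "parcs G = {(u, v). u \<in> pverts G \<and> v \<in> pverts G \<and> u \<noteq> v} - {(a, b), (b, a)}"
    by (rule arcs_if_card_pairs_at_dist)
  then have "digraph_iso (with_proj G) (with_proj (complete_graph_minus_edge (card (pverts G))))"
    by (rule digraph_iso_complete_graph_minus_edge[OF pair_graph])
  then show "digraph_iso (with_proj G) (with_proj (complete_graph_minus_edge n))"
    by (simp only: order)
qed

end
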